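(* Let $\varepsilon\in(0,1]$ and $n,r,q,t\ge1$ satisfy $\varepsilon r\ge 24q$. Let $\mathcal{A}\subset 2^{[n]}$ be a weakly $(r,t)$-spread family and let $\mathcal{S}\subset\binom{[n]}{\le q}$ be a non-trivial $t$-intersecting family. Then there exists a $t$-element set $T\subset[n]$ such that $|\mathcal{A}[\mathcal{S}]|\le\varepsilon|\mathcal{A}[T]|$.
   Context: For $X\subset[n]$ and $\mathcal{A}\subset2^{[n]}$: $\mathcal{A}(X)=\{A\setminus X: A\in\mathcal{A},\ X\subset A\}$, $\mathcal{A}[X]=\{A\in\mathcal{A}: X\subset A\}$, and $\mathcal{A}[\mathcal{S}]=\bigcup_{S\in\mathcal{S}}\mathcal{A}[S]$. $\mathcal{A}$ is weakly $(r,t)$-spread if there exists a set $T\subset[n]$ of size $t$ such that for every nonnegative integer $s$ and every $U\subset[n]$ with $|U|=t+s$ we have $|\mathcal{A}(U)|\le r^{-s}|\mathcal{A}(T)|$. A family $\mathcal{S}$ is $t$-intersecting if any two members share at least $t$ elements, and a $t$-intersecting family is non-trivial if $|\bigcap_{F\in\mathcal{S}}F|<t$. *)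

theory Defs
  imports Complex_Main
begin

text \<open>The ground set \<open>[n]\<close> is \<open>{1..n}\<close>.\<close>

definition link :: "nat set set \<Rightarrow> nat set \<Rightarrow> nat set set" where
  "link \<A> X = {A - X | A. A \<in> \<A> \<and> X \<subseteq> A}"

definition star :: "nat set set \<Rightarrow> nat set \<Rightarrow> nat set set" where
  "star \<A> X = {A \<in> \<A>. X \<subseteq> A}"

definition star_family :: "nat set set \<Rightarrow> nat set set \<Rightarrow> nat set set" where
  "star_family \<A> \<S> = (\<Union>S\<in>\<S>. star \<A> S)"

definition subsets_le :: "nat \<Rightarrow> nat \<Rightarrow> nat set set" where
  "subsets_le n q = {F. F \<subseteq> {1..n} \<and> card F \<le> q}"

definition weakly_spread :: "nat \<Rightarrow> real \<Rightarrow> nat \<Rightarrow> nat set set \<Rightarrow> bool" where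
  "weakly_spread n r t \<A> \<longleftrightarrow>
     (\<exists>T \<subseteq> {1..n}. card T = t \<and>
        (\<forall>s. \<forall>U \<subseteq> {1..n}. card U = t + s \<longrightarrow>
           real (card (link \<A> U)) \<le> r powi (- int s) * real (card (link \<A> T))))"

text \<open>The two members may coincide, so every member of a \<open>t\<close>-intersecting family
  has at least \<open>t\<close> elements.\<close>

definition t_intersecting :: "nat \<Rightarrow> nat set set \<Rightarrow> bool" where
  "t_intersecting t \<S> \<longleftrightarrow> (\<forall>F\<in>\<S>. \<forall>G\<in>\<S>. t \<le> card (F \<inter> G))"

text \<open>The intersection is taken inside \<open>{1..n}\<close>, so that the empty family has
  intersection \<open>{1..n}\<close> rather than the infinite set \<open>UNIV\<close>, whose \<open>card\<close> is \<open>0\<close>.\<close>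

definition nontrivial_t_intersecting :: "nat \<Rightarrow> nat \<Rightarrow> nat set set \<Rightarrow> bool" where
  "nontrivial_t_intersecting n t \<S> \<longleftrightarrow>
     t_intersecting t \<S> \<and> card ({1..n} \<inter> \<Inter>\<S>) < t"

end

theory Submission
  imports Defs
begin

text \<open>
  Shrink \<open>\<S>\<close> to a \<open>t\<close>-intersecting family in which no member can be replaced by a proper
  subset, and peel off its members of the maximal size \<open>t + s\<close>. There are at most
  \<open>(6 q) ^ s\<close> of them: fix one such member \<open>F\<close>; every other one contains one of the
  \<open>t + s choose s\<close> \<open>t\<close>-subsets of \<open>F\<close>, and is then reached by adding \<open>s\<close> elements,
  each of which can be restricted to at most \<open>2 s\<close> values. By spreadness this layer
  contributes at most \<open>(6 q / r) ^ s\<close>. Repeat with the remaining members until they all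
  contain a common \<open>t\<close>-set \<open>C\<close>. Then some peeled member \<open>F\<close> does not contain \<open>C\<close>, so
  each remaining member contains \<open>C\<close> together with an element of \<open>F - C\<close>, and these
  contribute at most \<open>q / r\<close>. Altogether the geometric series gives at most \<open>13 q / r\<close>.
\<close>

section \<open>Critical families: existence by shrinking members\<close>

text \<open>The witness \<open>F\<close> may be \<open>S\<close> itself. Since
  \<open>X \<inter> S = X\<close>, this is what handles the subsets \<open>X\<close> with fewer than
  \<open>t\<close> elements.\<close>

definition critical :: "nat \<Rightarrow> nat set set \<Rightarrow> bool" where
  "critical t \<T> \<longleftrightarrow> t_intersecting t \<T> \<and> (\<forall>S\<in>\<T>. \<forall>X. X \<subset> S \<longrightarrow> (\<exists>F\<in>\<T>. card (X \<inter> F) < t))"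

text \<open>Each replacement of a member by a proper subset lowers the total size of the members, so
  shrinking terminates. The third conclusion preserves the ground set and size bounds; the fourth
  ensures that passing to \<open>\<T>\<close> loses no set of the star family.\<close>

lemma exists_critical:
  assumes "finite \<S>" and "\<And>F. F \<in> \<S> \<Longrightarrow> finite F" and "t_intersecting t \<S>"
  shows "\<exists>\<T>. critical t \<T> \<and> finite \<T> \<and> (\<forall>F\<in>\<T>. \<exists>G\<in>\<S>. F \<subseteq> G) \<and> (\<forall>G\<in>\<S>. \<exists>F\<in>\<T>. F \<subseteq> G)"
  using assms
proof (induction "\<Sum>F\<in>\<S>. card F" arbitrary: \<S> rule: less_induct)
  case less
  show ?case
  proof (cases "critical t \<S>")
    case True
    then show ?thesis using less.prems by blast
  next
    case False
    then obtain S X where S: "S \<in> \<S>" "X \<subset> S" and X: "\<And>F. F \<in> \<S> \<Longrightarrow> t \<le> card (X \<inter> F)"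
      unfolding critical_def using less.prems(3) by (meson not_less)
    define \<S>' where "\<S>' = insert X (\<S> - {S})"
    have fin: "finite S" "finite \<S>'" "\<And>F. F \<in> \<S>' \<Longrightarrow> finite F"
      using less.prems S unfolding \<S>'_def by (auto intro: finite_subset)
    \<comment> \<open>Only an inequality, because \<open>X\<close> may already be a member of
      \<open>\<S>\<close>.\<close>
    have "(\<Sum>F\<in>\<S>'. card F) \<le> card X + (\<Sum>F\<in>\<S> - {S}. card F)"
      unfolding \<S>'_def using less.prems(1) by (simp add: sum.insert_if)
    also have "\<dots> < card S + (\<Sum>F\<in>\<S> - {S}. card F)"
      using psubset_card_mono[OF fin(1) S(2)] by simp
    also have "\<dots> = (\<Sum>F\<in>\<S>. card F)"
      using less.prems(1) S(1) by (simp add: sum.remove)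
    finally have smaller: "(\<Sum>F\<in>\<S>'. card F) < (\<Sum>F\<in>\<S>. card F)" .
    have "X \<inter> S = X \<inter> X" using S(2) by blast
    then have XX: "t \<le> card (X \<inter> X)" using X[OF S(1)] by simp
    have "t \<le> card (F \<inter> G)" if FG: "F \<in> \<S>'" "G \<in> \<S>'" for F G
    proof -
      have "t \<le> card (F \<inter> G)" if "F = X \<or> G = X"
        using that FG X XX unfolding \<S>'_def by (auto simp: Int_commute)
      moreover have "t \<le> card (F \<inter> G)" if "F \<noteq> X" "G \<noteq> X"
        using that FG less.prems(3) unfolding \<S>'_def t_intersecting_def by auto
      ultimately show ?thesis by blast
    qed
    then have "t_intersecting t \<S>'" unfolding t_intersecting_def by blast
    from less.hyps[OF smaller fin(2,3) this] obtain \<T> where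
      \<T>: "critical t \<T>" "finite \<T>" "\<forall>F\<in>\<T>. \<exists>G\<in>\<S>'. F \<subseteq> G" "\<forall>G\<in>\<S>'. \<exists>F\<in>\<T>. F \<subseteq> G"
      by blast
    have "\<exists>G\<in>\<S>. H \<subseteq> G" if "H \<in> \<S>'" for H
      using that S unfolding \<S>'_def by auto
    then have "\<forall>F\<in>\<T>. \<exists>G\<in>\<S>. F \<subseteq> G" using \<T>(3) by (meson subset_trans)
    moreover have "\<exists>H\<in>\<S>'. H \<subseteq> G" if "G \<in> \<S>" for G
      using that S unfolding \<S>'_def by auto
    then have "\<forall>G\<in>\<S>. \<exists>F\<in>\<T>. F \<subseteq> G" using \<T>(4) by (meson subset_trans)
    ultimately show ?thesis using \<T>(1,2) by blast
  qed
qed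

section \<open>Counting the members of maximal size in a critical family\<close>

text \<open>A branching argument, with \<open>m\<close> the number of elements still missing from
  \<open>X\<close>. Criticality yields \<open>F\<close> meeting \<open>X\<close> in fewer than
  \<open>t\<close> elements; every member containing \<open>X\<close> meets \<open>F\<close> in at
  least \<open>t\<close>, so it contains one of the elements of \<open>F - X\<close>.\<close>

lemma card_critical_superset_le:
  assumes "critical t \<T>" and "\<And>F. F \<in> \<T> \<Longrightarrow> finite F \<and> card F \<le> t + s"
    and "finite \<T>" and "card X + m = t + s" and "t \<le> card X"
  shows "card {S \<in> \<T>. X \<subseteq> S \<and> card S = t + s} \<le> (2 * s) ^ m"
  using assms(4,5)
proof (induction m arbitrary: X)
  case 0
  have "{S \<in> \<T>. X \<subseteq> S \<and> card S = t + s} \<subseteq> {X}"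
    using 0 assms(2) card_subset_eq[of _ X] by fastforce
  then show ?case using card_mono[of "{X}"] by fastforce
next
  case (Suc m)
  let ?N = "\<lambda>Y. {S \<in> \<T>. Y \<subseteq> S \<and> card S = t + s}"
  show ?case
  proof (cases "?N X = {}")
    case True
    then show ?thesis by (metis card.empty le0)
  next
    case False
    then obtain S where S: "S \<in> \<T>" "X \<subseteq> S" "card S = t + s" by blast
    with Suc.prems have "X \<subset> S" by auto
    then obtain F where F: "F \<in> \<T>" "card (X \<inter> F) < t"
      using assms(1) S(1) unfolding critical_def by blast
    have finS: "finite S" and finF: "finite F" "card F \<le> t + s"
      using assms(2) S(1) F(1) by auto
    then have finX: "finite X" using S(2) finite_subset by blast
    have "t \<le> card (F \<inter> S)"
      using assms(1) F(1) S(1) unfolding critical_def t_intersecting_def by blast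
    also have "\<dots> \<le> card ((X \<inter> F) \<union> (S - X))"
      using finS finF by (intro card_mono) auto
    also have "\<dots> \<le> card (X \<inter> F) + card (S - X)" by (rule card_Un_le)
    also have "card (S - X) = Suc m"
      using S Suc.prems finX by (simp add: card_Diff_subset)
    finally have "t \<le> card (X \<inter> F) + Suc m" .
    moreover have "card (F - X) + card (X \<inter> F) = card F"
      using finF by (metis Int_commute card_Diff_subset_Int card_mono finite_Int inf_le1 le_add_diff_inverse2)
    \<comment> \<open>At most \<open>(t + s) - (t - Suc m) = s + Suc m\<close> elements of
      \<open>F\<close> lie outside \<open>X\<close>, and \<open>Suc m \<le> s\<close> because
      \<open>t \<le> card X\<close>.\<close>
    ultimately have FX: "card (F - X) \<le> 2 * s" using finF(2) Suc.prems by linarith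
    have "?N X \<subseteq> (\<Union>x\<in>F - X. ?N (insert x X))"
    proof
      fix S' assume S': "S' \<in> ?N X"
      have "t \<le> card (F \<inter> S')"
        using assms(1) F(1) S' unfolding critical_def t_intersecting_def by blast
      then have "\<not> F \<inter> S' \<subseteq> X \<inter> F"
        using F(2) card_mono[of "X \<inter> F" "F \<inter> S'"] finF by fastforce
      then show "S' \<in> (\<Union>x\<in>F - X. ?N (insert x X))" using S' by blast
    qed
    then have "card (?N X) \<le> card (\<Union>x\<in>F - X. ?N (insert x X))"
      using finF assms(3) by (intro card_mono) auto
    also have "\<dots> \<le> (\<Sum>x\<in>F - X. card (?N (insert x X)))"
      using finF by (intro card_UN_le) auto
    also have "\<dots> \<le> (\<Sum>x\<in>F - X. (2 * s) ^ m)"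
      using Suc.prems finX by (intro sum_mono Suc.IH) auto
    also have "\<dots> \<le> (2 * s) ^ Suc m" using FX by simp
    finally show ?thesis .
  qed
qed

lemma card_critical_top_le:
  assumes "critical t \<T>" and "\<And>F. F \<in> \<T> \<Longrightarrow> finite F \<and> card F \<le> t + s" and "finite \<T>"
  shows "card {S \<in> \<T>. card S = t + s} \<le> (t + s choose s) * (2 * s) ^ s"
proof (cases "{S \<in> \<T>. card S = t + s} = {}")
  case True
  then show ?thesis by (metis card.empty le0)
next
  case False
  then obtain F where F: "F \<in> \<T>" "card F = t + s" by blast
  then have finF: "finite F" using assms(2) by blast
  let ?P = "{X. X \<subseteq> F \<and> card X = t}" and ?N = "\<lambda>X. {S \<in> \<T>. X \<subseteq> S \<and> card S = t + s}"
  have finP: "finite ?P" using finF by simp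
  have "{S \<in> \<T>. card S = t + s} \<subseteq> (\<Union>X\<in>?P. ?N X)"
  proof
    fix S assume S: "S \<in> {S \<in> \<T>. card S = t + s}"
    have "t \<le> card (F \<inter> S)"
      using assms(1) F(1) S unfolding critical_def t_intersecting_def by blast
    then obtain X where "X \<subseteq> F \<inter> S" "card X = t" by (meson obtain_subset_with_card_n)
    then show "S \<in> (\<Union>X\<in>?P. ?N X)" using S by blast
  qed
  then have "card {S \<in> \<T>. card S = t + s} \<le> card (\<Union>X\<in>?P. ?N X)"
    using finP assms(3) by (intro card_mono) auto
  also have "\<dots> \<le> (\<Sum>X\<in>?P. card (?N X))"
    using finP by (rule card_UN_le)
  also have "\<dots> \<le> (\<Sum>X\<in>?P. (2 * s) ^ s)"
    using assms by (intro sum_mono card_critical_superset_le) auto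
  also have "\<dots> = (t + s choose s) * (2 * s) ^ s"
    using n_subsets[OF finF, of t] F(2) binomial_symmetric[of t "t + s"] by simp
  finally show ?thesis .
qed

section \<open>Numerical estimates\<close>

text \<open>Keep a single term of the exponential series at \<open>s\<close> and use that e is at
  most 3.\<close>

lemma power_self_le_fact: "real s ^ s \<le> 3 ^ s * fact s"
proof -
  have "(\<Sum>i\<in>{s}. inverse (fact i) * real s ^ i) \<le> (\<Sum>i. inverse (fact i) * real s ^ i)"
    using summable_exp[of "real s"] by (intro sum_le_suminf) auto
  then have "real s ^ s / fact s \<le> exp (real s)"
    by (simp add: exp_def field_simps)
  also have "\<dots> = exp 1 ^ s" by (simp flip: exp_of_nat_mult)
  also have "\<dots> \<le> 3 ^ s" by (intro power_mono exp_le) simp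
  finally show ?thesis by (simp add: field_simps)
qed

text \<open>The factorial in \<open>k ^ s / fact s\<close> cancels the one bounding
  \<open>s ^ s\<close>, which leaves the base \<open>6 = 2 * 3\<close> independent of
  \<open>s\<close>.\<close>

lemma binomial_times_power_le: "real ((k choose s) * (2 * s) ^ s) \<le> (6 * real k) ^ s"
proof -
  have "(k choose s) * fact s \<le> k ^ s" by (rule binomial_fact_pow)
  then have binom: "real (k choose s) * fact s \<le> real k ^ s"
    by (metis of_nat_fact of_nat_le_iff of_nat_mult of_nat_power)
  have "real ((k choose s) * (2 * s) ^ s) = 2 ^ s * real (k choose s) * real s ^ s"
    by (simp add: power_mult_distrib)
  also have "\<dots> \<le> 2 ^ s * real (k choose s) * (3 ^ s * fact s)"
    by (intro mult_left_mono power_self_le_fact) simp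
  also have "\<dots> = 6 ^ s * (real (k choose s) * fact s)"
    by (simp flip: power_mult_distrib)
  also have "\<dots> \<le> 6 ^ s * real k ^ s" by (intro mult_left_mono binom) simp
  finally show ?thesis by (simp add: power_mult_distrib)
qed

lemma geometric_sum_le:
  fixes x :: real
  assumes "0 \<le> x" "x \<le> 1 / 2"
  shows "(\<Sum>j<s. x ^ Suc j) \<le> 2 * x"
proof -
  \<comment> \<open>The subtracted term makes the induction work: its step needs just
    \<open>2 * x \<le> 1\<close>.\<close>
  have "(\<Sum>j<s. x ^ Suc j) \<le> 2 * x - 2 * x ^ Suc s"
  proof (induction s)
    case (Suc s)
    have "2 * x * x ^ Suc s \<le> 1 * x ^ Suc s"
      using assms by (intro mult_right_mono) auto
    with Suc show ?case by simp
  qed simp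
  then show ?thesis using zero_le_power[OF assms(1), of "Suc s"] by linarith
qed

section \<open>Stars, links and union bounds\<close>

lemma card_link: "card (link \<A> X) = card (star \<A> X)"
proof -
  have "link \<A> X = (\<lambda>A. A - X) ` star \<A> X" unfolding link_def star_def by blast
  moreover have "inj_on (\<lambda>A. A - X) (star \<A> X)"
    unfolding inj_on_def star_def by blast
  ultimately show ?thesis by (simp add: card_image)
qed

lemma card_star_family_le:
  assumes "finite \<A>" and "finite \<U>" and "\<And>U. U \<in> \<U> \<Longrightarrow> real (card (star \<A> U)) \<le> b"
  shows "real (card (star_family \<A> \<U>)) \<le> real (card \<U>) * b"
proof -
  have "card (star_family \<A> \<U>) \<le> (\<Sum>U\<in>\<U>. card (star \<A> U))"
    unfolding star_family_def using assms(2) by (rule card_UN_le)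
  then have "real (card (star_family \<A> \<U>)) \<le> (\<Sum>U\<in>\<U>. real (card (star \<A> U)))"
    by (metis of_nat_le_iff of_nat_sum)
  also have "\<dots> \<le> real (card \<U>) * b" using assms(3) by (intro sum_bounded_above)
  finally show ?thesis .
qed

section \<open>The peeling induction\<close>

text \<open>Induction on the excess \<open>s\<close> of member sizes over \<open>t\<close>.
  Non-triviality is phrased through common \<open>t\<close>-sets \<open>C\<close>, so that for the
  remaining members it either persists, and the induction hypothesis applies, or fails with an
  explicit \<open>C\<close>. The sum pays for the layers, \<open>q / r\<close> for the last
  stage.\<close>

lemma card_star_family_peeling_le:
  fixes M r :: real and n q s t :: nat
  assumes \<A>: "\<A> \<subseteq> Pow {1..n}" and r: "r > 0" and M: "M \<ge> 0"
    and spread: "\<And>U s. U \<subseteq> {1..n} \<Longrightarrow> card U = t + s \<Longrightarrow> real (card (star \<A> U)) \<le> M / r ^ s"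
    and "\<S> \<subseteq> subsets_le n (t + s)" and "t_intersecting t \<S>"
    and "\<And>C. C \<subseteq> {1..n} \<Longrightarrow> card C = t \<Longrightarrow> \<exists>F\<in>\<S>. \<not> C \<subseteq> F"
    and "t + s \<le> q"
  shows "real (card (star_family \<A> \<S>)) \<le> M * (real q / r + (\<Sum>j<s. (6 * real q / r) ^ Suc j))"
  using assms(5-)
proof (induction s arbitrary: \<S>)
  case 0
  \<comment> \<open>Members of size at most \<open>t\<close> that pairwise share \<open>t\<close>
    elements coincide, so a member would itself be a common \<open>t\<close>-set.\<close>
  have "\<S> = {}"
  proof (rule ccontr)
    assume "\<S> \<noteq> {}"
    then obtain F where F: "F \<in> \<S>" by blast
    then have FF: "F \<subseteq> {1..n}" "card F \<le> t" using 0 unfolding subsets_le_def by auto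
    then have finF: "finite F" using finite_subset by blast
    have sub: "F \<subseteq> G \<and> card F = t" if "G \<in> \<S>" for G
    proof -
      have "t \<le> card (F \<inter> G)" using 0(2) F that unfolding t_intersecting_def by blast
      moreover have "card (F \<inter> G) \<le> card F" using finF by (intro card_mono) auto
      ultimately have "card (F \<inter> G) = card F" "card F = t" using FF(2) by auto
      then show ?thesis using card_subset_eq[OF finF, of "F \<inter> G"] by auto
    qed
    then show False using 0(3)[OF FF(1)] F by blast
  qed
  then show ?case using M r by (simp add: star_family_def)
next
  case (Suc s)
  let ?k = "t + Suc s"
  have "finite (subsets_le n ?k)"
    by (rule finite_subset[of _ "Pow {1..n}"]) (auto simp: subsets_le_def)
  then have fin\<S>: "finite \<S>" using Suc.prems(1) finite_subset by blast
  have finm: "finite F" if "F \<in> \<S>" for F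
    using that Suc.prems(1) unfolding subsets_le_def by (auto intro: finite_subset)
  obtain \<T> where crit: "critical t \<T>" and fin: "finite \<T>"
    and below: "\<forall>F\<in>\<T>. \<exists>G\<in>\<S>. F \<subseteq> G" and above: "\<forall>G\<in>\<S>. \<exists>F\<in>\<T>. F \<subseteq> G"
    using exists_critical[OF fin\<S> finm Suc.prems(2)] by blast
  have \<T>: "F \<subseteq> {1..n}" "finite F" "card F \<le> ?k" if F: "F \<in> \<T>" for F
  proof -
    obtain G where G: "G \<in> \<S>" "F \<subseteq> G" using below F by blast
    then have "G \<subseteq> {1..n}" "card G \<le> ?k" using Suc.prems(1) unfolding subsets_le_def by auto
    then show "F \<subseteq> {1..n}" "finite F" "card F \<le> ?k"
      using G finm[OF G(1)] card_mono[of G F] finite_subset[of F G] by auto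
  qed
  have int: "t_intersecting t \<T>" using crit unfolding critical_def by blast
  have fin\<A>: "finite \<A>" using \<A> finite_subset by auto
  define W where "W = {S \<in> \<T>. card S = ?k}"
  define V where "V = \<T> - W"
  have split: "star_family \<A> \<S> \<subseteq> star_family \<A> W \<union> star_family \<A> V"
  proof
    fix A assume "A \<in> star_family \<A> \<S>"
    then obtain G where G: "G \<in> \<S>" "A \<in> \<A>" "G \<subseteq> A" unfolding star_family_def star_def by blast
    then obtain F where "F \<in> \<T>" "F \<subseteq> G" using above by blast
    then have "F \<in> W \<union> V" "F \<subseteq> A" using G(3) unfolding V_def by auto
    then show "A \<in> star_family \<A> W \<union> star_family \<A> V"
      using G(2) unfolding star_family_def star_def by blast
  qed
  have finu: "finite (star_family \<A> \<U>)" for \<U>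
    by (rule finite_subset[OF _ fin\<A>]) (auto simp: star_family_def star_def)
  have "real (card W) \<le> real ((?k choose Suc s) * (2 * Suc s) ^ Suc s)"
    unfolding W_def of_nat_le_iff
    using crit \<T> fin by (intro card_critical_top_le) auto
  also have "\<dots> \<le> (6 * real ?k) ^ Suc s" by (rule binomial_times_power_le)
  \<comment> \<open>Replacing the current size by the fixed \<open>q\<close> makes all layer bounds
    powers of one ratio, hence a geometric series.\<close>
  also have "\<dots> \<le> (6 * real q) ^ Suc s" using Suc.prems(4) by (intro power_mono) auto
  finally have cardW: "real (card W) \<le> (6 * real q) ^ Suc s" .
  have "real (card (star_family \<A> W)) \<le> real (card W) * (M / r ^ Suc s)"
    using fin fin\<A> \<T>(1) unfolding W_def by (intro card_star_family_le spread) auto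
  also have "\<dots> \<le> (6 * real q) ^ Suc s * (M / r ^ Suc s)"
    using cardW M r by (intro mult_right_mono) auto
  finally have boundW: "real (card (star_family \<A> W)) \<le> M * (6 * real q / r) ^ Suc s"
    by (simp add: power_divide mult_ac)
  have boundV: "real (card (star_family \<A> V)) \<le> M * (real q / r + (\<Sum>j<s. (6 * real q / r) ^ Suc j))"
  proof (cases "\<exists>C\<subseteq>{1..n}. card C = t \<and> (\<forall>F\<in>V. C \<subseteq> F)")
    case False
    show ?thesis
    proof (rule Suc.IH)
      show "V \<subseteq> subsets_le n (t + s)"
      proof
        fix F assume "F \<in> V"
        then have "F \<in> \<T>" "card F \<noteq> ?k" unfolding V_def W_def by auto
        then show "F \<in> subsets_le n (t + s)" using \<T>[of F] unfolding subsets_le_def by auto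
      qed
      show "t_intersecting t V" using int unfolding V_def t_intersecting_def by blast
      show "\<exists>F\<in>V. \<not> C \<subseteq> F" if "C \<subseteq> {1..n}" "card C = t" for C using False that by blast
      show "t + s \<le> q" using Suc.prems(4) by simp
    qed
  next
    case True
    then obtain C where C: "C \<subseteq> {1..n}" "card C = t" "\<And>F. F \<in> V \<Longrightarrow> C \<subseteq> F" by blast
    have finC: "finite C" using C(1) finite_subset by blast
    \<comment> \<open>Non-triviality is known for \<open>\<S>\<close> only; a subset
      \<open>F\<close> of \<open>G\<close> taken from \<open>\<T>\<close> still fails to contain
      \<open>C\<close>.\<close>
    obtain G where G: "G \<in> \<S>" "\<not> C \<subseteq> G" using Suc.prems(3) C by blast
    then obtain F where F: "F \<in> \<T>" "F \<subseteq> G" using above by blast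
    then have nC: "\<not> C \<subseteq> F" using G by blast
    let ?U = "(\<lambda>x. insert x C) ` (F - C)"
    have "star_family \<A> V \<subseteq> star_family \<A> ?U"
    proof
      fix A assume "A \<in> star_family \<A> V"
      then obtain H where H: "H \<in> V" "A \<in> \<A>" "H \<subseteq> A"
        unfolding star_family_def star_def by blast
      \<comment> \<open>Otherwise the intersection, having at least \<open>t\<close> elements, would
        equal \<open>C\<close> and force \<open>C \<subseteq> F\<close>. So \<open>H\<close>
        contains some \<open>insert x C\<close> of size \<open>t + 1\<close>, to which spreadness
        applies with exponent 1.\<close>
      have "\<not> F \<inter> H \<subseteq> C"
      proof
        assume "F \<inter> H \<subseteq> C"
        moreover have "t \<le> card (F \<inter> H)"
          using int F(1) H(1) unfolding V_def t_intersecting_def by blast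
        ultimately have "F \<inter> H = C" using C(2) finC by (intro card_seteq) auto
        then show False using nC by blast
      qed
      then obtain x where "x \<in> F - C" "x \<in> H" by blast
      then show "A \<in> star_family \<A> ?U"
        using H C(3)[OF H(1)] unfolding star_family_def star_def by blast
    qed
    then have "real (card (star_family \<A> V)) \<le> real (card (star_family \<A> ?U))"
      using finu by (simp add: card_mono)
    also have "\<dots> \<le> real (card ?U) * (M / r ^ 1)"
    proof (rule card_star_family_le[OF fin\<A>])
      show "finite ?U" using \<T>(2)[OF F(1)] by blast
      show "real (card (star \<A> U)) \<le> M / r ^ 1" if "U \<in> ?U" for U
        using that C \<T>(1)[OF F(1)] finC by (intro spread) auto
    qed
    also have "\<dots> \<le> real q * (M / r ^ 1)"
    proof (rule mult_right_mono)
      have "card ?U \<le> card (F - C)" using \<T>(2)[OF F(1)] by (intro card_image_le) blast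
      also have "\<dots> \<le> card F" using \<T>(2)[OF F(1)] by (intro card_mono) auto
      finally show "real (card ?U) \<le> real q" using \<T>(3)[OF F(1)] Suc.prems(4) by linarith
    qed (use M r in auto)
    also have "\<dots> \<le> M * (real q / r + (\<Sum>j<s. (6 * real q / r) ^ Suc j))"
    proof -
      have "0 \<le> M * (\<Sum>j<s. (6 * real q / r) ^ Suc j)"
        using M r by (intro mult_nonneg_nonneg sum_nonneg) auto
      then show ?thesis by (simp add: distrib_left mult.commute)
    qed
    finally show ?thesis .
  qed
  have "card (star_family \<A> \<S>) \<le> card (star_family \<A> W) + card (star_family \<A> V)"
    using card_mono[OF _ split] card_Un_le[of "star_family \<A> W" "star_family \<A> V"] finu
    by (meson finite_UnI order_trans)
  then have "real (card (star_family \<A> \<S>)) \<le> card (star_family \<A> W) + card (star_family \<A> V)"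
    by linarith
  also have "\<dots> \<le> M * (6 * real q / r) ^ Suc s + M * (real q / r + (\<Sum>j<s. (6 * real q / r) ^ Suc j))"
    using boundW boundV by simp
  finally show ?case by (simp add: algebra_simps)
qed

section \<open>Applying the peeling bound to a weakly spread family\<close>

theorem theorem12:
  fixes \<epsilon> r :: real and n q t :: nat and \<A> \<S> :: "nat set set"
  assumes "0 < \<epsilon>" and "\<epsilon> \<le> 1"
    and "n \<ge> 1" and "r \<ge> 1" and "q \<ge> 1" and "t \<ge> 1"
    and "\<epsilon> * r \<ge> 24 * real q"
    and "\<A> \<subseteq> Pow {1..n}"
    and "weakly_spread n r t \<A>"
    and "\<S> \<subseteq> subsets_le n q"
    and "nontrivial_t_intersecting n t \<S>"
  shows "\<exists>T \<subseteq> {1..n}. card T = t \<and>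
           real (card (star_family \<A> \<S>)) \<le> \<epsilon> * real (card (star \<A> T))"
proof -
  obtain T where T: "T \<subseteq> {1..n}" "card T = t"
    and spr: "\<And>s U. U \<subseteq> {1..n} \<Longrightarrow> card U = t + s \<Longrightarrow>
      real (card (link \<A> U)) \<le> r powi (- int s) * real (card (link \<A> T))"
    using assms(9) unfolding weakly_spread_def by blast
  let ?M = "real (card (star \<A> T))"
  have spread: "real (card (star \<A> U)) \<le> ?M / r ^ s" if "U \<subseteq> {1..n}" "card U = t + s" for U s
    using spr[OF that] by (simp add: card_link power_int_minus divide_inverse mult.commute)
  have int: "t_intersecting t \<S>" and small: "card ({1..n} \<inter> \<Inter>\<S>) < t"
    using assms(11) unfolding nontrivial_t_intersecting_def by auto
  have nontriv: "\<exists>F\<in>\<S>. \<not> C \<subseteq> F" if C: "C \<subseteq> {1..n}" "card C = t" for C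
  proof (rule ccontr)
    assume "\<not> (\<exists>F\<in>\<S>. \<not> C \<subseteq> F)"
    then have "card C \<le> card ({1..n} \<inter> \<Inter>\<S>)" using C(1) by (intro card_mono) auto
    then show False using small C(2) by simp
  qed
  \<comment> \<open>A member exists because \<open>T\<close> is not contained in all of them; it
    gives \<open>t \<le> q\<close>, so the subtraction \<open>q - t\<close> is not
    truncated.\<close>
  obtain F where F: "F \<in> \<S>" using nontriv[OF T] by blast
  then have "t \<le> card (F \<inter> F)" using int unfolding t_intersecting_def by blast
  moreover have "card F \<le> q" using F assms(10) unfolding subsets_le_def by blast
  ultimately have tq: "t + (q - t) = q" by simp
  have x: "6 * real q / r \<le> 1 / 2"
  proof -
    have "\<epsilon> * r \<le> 1 * r" using assms(2,4) by (intro mult_right_mono) auto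
    then have "24 * real q \<le> r" using assms(7) by linarith
    then show ?thesis using assms(4) by (simp add: field_simps)
  qed
  have "real (card (star_family \<A> \<S>)) \<le> ?M * (real q / r + (\<Sum>j<q - t. (6 * real q / r) ^ Suc j))"
  proof (rule card_star_family_peeling_le[OF assms(8) _ _ spread _ int nontriv])
    show "\<S> \<subseteq> subsets_le n (t + (q - t))" using assms(10) tq by simp
  qed (use assms(4) tq in auto)
  also have "\<dots> \<le> ?M * (real q / r + 2 * (6 * real q / r))"
    using x assms(4) by (intro mult_left_mono add_left_mono geometric_sum_le) auto
  \<comment> \<open>The bracket equals \<open>13 * q / r\<close>, and
    \<open>24 * q \<le> \<epsilon> * r\<close>.\<close>
  also have "\<dots> \<le> ?M * \<epsilon>"
    using assms(4,7) by (intro mult_left_mono) (auto simp: field_simps)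
  finally show ?thesis using T by (auto simp: mult.commute)
qed

end
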